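(* Let $\Omega=\prod_{k=1}^n\Omega_k$ with product probability measure $\mu=\bigotimes_{k=1}^n\mu_k$, and let $f$ be a bounded measurable real function on $\Omega$. Then for every $t>0$ $$\Pr\{f-E[f]>t\}\le\exp\left(\frac{-t^2}{2\Vert Df\Vert_\infty}\right).$$
   Context: $E[g]=\int_\Omega g\,\mathrm{d}\mu$, $\Pr$ is probability under $\mu$, and $\Vert\cdot\Vert_\infty$ is the norm of $L_\infty[\mu]$. For $\mathbf{x}\in\Omega$ and $y\in\Omega_k$, $\mathbf{x}_{y,k}$ denotes $\mathbf{x}$ with its $k$th coordinate replaced by $y$, and $(\inf_kg)(\mathbf{x})=\inf_{y\in\Omega_k}g(\mathbf{x}_{y,k})$. The worst-case variance proxy of $g$ is the function $Dg=\sum_{k=1}^n(g-\inf_kg)^2$. Measurability questions are ignored: the functions $\inf_kf$ are assumed measurable. If $\Vert Df\Vert_\infty=0$ the right-hand side is read as $0$. *)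

theory Defs
  imports "HOL-Probability.Probability"
begin

definition inf_coord ::
  "('i \<Rightarrow> 'a measure) \<Rightarrow> 'i \<Rightarrow> (('i \<Rightarrow> 'a) \<Rightarrow> real) \<Rightarrow> ('i \<Rightarrow> 'a) \<Rightarrow> real"
  where "inf_coord M k g x = (INF y\<in>space (M k). g (x(k := y)))"

definition variance_proxy ::
  "(nat \<Rightarrow> 'a measure) \<Rightarrow> nat \<Rightarrow> ((nat \<Rightarrow> 'a) \<Rightarrow> real) \<Rightarrow> (nat \<Rightarrow> 'a) \<Rightarrow> real"
  where "variance_proxy M n g x = (\<Sum>k = 1..n. (g x - inf_coord M k g x)\<^sup>2)"

(* The value is the usual norm only for measurable, essentially bounded g:
   otherwise esssup is infinite, and real_of_ereal turns that into 0. *)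
definition Linf_norm :: "'a measure \<Rightarrow> ('a \<Rightarrow> real) \<Rightarrow> real"
  where "Linf_norm M g = real_of_ereal (esssup M (\<lambda>x. ereal \<bar>g x\<bar>))"

end

theory Submission
  imports Defs "HOL-Real_Asymp.Real_Asymp"
begin

text \<open>
  The proof is the entropy method. Entropy is subadditive over the factors of a product, and
  \<open>rel_ent g c\<close> with \<open>c\<close> independent of the \<open>k\<close>-th coordinate bounds the entropy in that coordinate.
  Taking \<open>g = exp (\<beta> * f)\<close> and \<open>c = exp (\<beta> * inf\<^sub>k f)\<close>, the inequality
  \<open>exp (- x) \<le> 1 - x + x\<^sup>2 / 2\<close> for \<open>x \<ge> 0\<close> bounds the entropy of \<open>exp (\<beta> * f)\<close> by
  \<open>\<beta>\<^sup>2 / 2 * \<parallel>Df\<parallel> * E (exp (\<beta> * f))\<close>. Herbst's argument integrates this to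
  \<open>E (exp (\<beta> * (f - E f))) \<le> exp (\<beta>\<^sup>2 / 2 * \<parallel>Df\<parallel>)\<close>, and Markov's inequality with
  \<open>\<beta> = t / \<parallel>Df\<parallel>\<close> (or \<open>\<beta> \<rightarrow> \<infinity>\<close> if the norm vanishes) concludes.
\<close>

section \<open>Relative entropy of positive numbers: tangent planes and bounds\<close>

text \<open>This is the Bregman divergence of x * ln x: its value at \<open>g\<close> minus the
  value at \<open>g\<close> of its tangent line at \<open>c\<close>.\<close>

definition rel_ent :: "real \<Rightarrow> real \<Rightarrow> real"
  where "rel_ent g c = g * (ln g - ln c) - g + c"

definition entropy_of :: "'a measure \<Rightarrow> ('a \<Rightarrow> real) \<Rightarrow> real"
  where "entropy_of M g = (\<integral>x. g x * ln (g x) \<partial>M) - (\<integral>x. g x \<partial>M) * ln (\<integral>x. g x \<partial>M)"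

text \<open>\<open>rel_ent\<close> is jointly convex and homogeneous of degree 1, so its tangent
  plane at \<open>(G, C)\<close> is linear without a constant term and lies below it. The
  coefficients are the partial derivatives there; the inequality itself is ln z \<le> z - 1 at z = c
  * G / (C * g).\<close>

lemma rel_ent_tangent:
  assumes "g > 0" "c > 0" "G > 0" "C > 0"
  shows "rel_ent g c \<ge> g * (ln G - ln C) + c * (1 - G / C)"
proof -
  have "ln (c * G / (C * g)) \<le> c * G / (C * g) - 1"
    using assms by (intro ln_le_minus_one) simp
  then have "g * ln (c * G / (C * g)) \<le> g * (c * G / (C * g) - 1)"
    using assms by (intro mult_left_mono) auto
  also have "\<dots> = c * G / C - g"
    using assms by (simp add: field_simps)
  finally show ?thesis
    using assms by (simp add: rel_ent_def ln_mult ln_div algebra_simps)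
qed

lemma rel_ent_nonneg: "g > 0 \<Longrightarrow> c > 0 \<Longrightarrow> rel_ent g c \<ge> 0"
  using rel_ent_tangent[of g c 1 1] by simp

lemma rel_ent_bounded:
  assumes "0 < a" "g \<in> {a..b}" "c \<in> {a..b}"
  shows "\<bar>rel_ent g c\<bar> \<le> b * (ln b - ln a) + (b - a)"
proof -
  have "a \<le> g" "g \<le> b" "a \<le> c" "c \<le> b" using assms by auto
  have "ln a \<le> ln g" "ln g \<le> ln b" "ln a \<le> ln c" "ln c \<le> ln b"
    using assms by auto
  then have "\<bar>ln g - ln c\<bar> \<le> ln b - ln a" by linarith
  then have "\<bar>g * (ln g - ln c)\<bar> \<le> b * (ln b - ln a)"
    unfolding abs_mult using assms by (intro mult_mono) auto
  moreover have "\<bar>c - g\<bar> \<le> b - a" using assms by auto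
  ultimately show ?thesis unfolding rel_ent_def by linarith
qed

section \<open>Integrability of bounded functions, Jensen's inequality for relative entropy and a
  variational bound for entropy\<close>

lemma (in prob_space) integrable_bounded:
  assumes "f \<in> borel_measurable M" "\<And>x. x \<in> space M \<Longrightarrow> \<bar>f x\<bar> \<le> (B::real)"
  shows "integrable M f"
  using assms by (intro integrable_const_bound[of _ B]) auto

lemma (in prob_space) integral_in_interval:
  assumes "f \<in> borel_measurable M" "\<And>x. x \<in> space M \<Longrightarrow> f x \<in> {a..b::real}"
  shows "integrable M f" "(\<integral>x. f x \<partial>M) \<in> {a..b}"
proof -
  show i: "integrable M f"
    by (rule integrable_bounded[where B = "max \<bar>a\<bar> \<bar>b\<bar>"]) (use assms in fastforce)+
  show "(\<integral>x. f x \<partial>M) \<in> {a..b}"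
    using integral_ge_const[OF i, of a] integral_le_const[OF i, of b] assms(2) by auto
qed

lemma (in prob_space) integrable_mult_ln:
  fixes g :: "'a \<Rightarrow> real"
  assumes [measurable]: "g \<in> borel_measurable M"
    and "0 < a" "\<And>x. x \<in> space M \<Longrightarrow> g x \<in> {a..b}"
  shows "integrable M (\<lambda>x. g x * ln (g x))"
proof (rule integrable_bounded[where B = "b * max \<bar>ln a\<bar> \<bar>ln b\<bar>"])
  fix x assume "x \<in> space M"
  from assms(3)[OF this] have "a \<le> g x" "g x \<le> b" by auto
  then have "ln a \<le> ln (g x)" "ln (g x) \<le> ln b" using \<open>0 < a\<close> by auto
  then have "\<bar>ln (g x)\<bar> \<le> max \<bar>ln a\<bar> \<bar>ln b\<bar>" by linarith
  then show "\<bar>g x * ln (g x)\<bar> \<le> b * max \<bar>ln a\<bar> \<bar>ln b\<bar>"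
    unfolding abs_mult using \<open>0 < a\<close> \<open>a \<le> g x\<close> \<open>g x \<le> b\<close> by (intro mult_mono) auto
qed measurable

lemma (in prob_space) integrable_rel_ent:
  assumes [measurable]: "g \<in> borel_measurable M" "c \<in> borel_measurable M"
    and "0 < a" "\<And>x. x \<in> space M \<Longrightarrow> g x \<in> {a..b}" "\<And>x. x \<in> space M \<Longrightarrow> c x \<in> {a..b}"
  shows "integrable M (\<lambda>x. rel_ent (g x) (c x))"
proof (rule integrable_bounded)
  show "(\<lambda>x. rel_ent (g x) (c x)) \<in> borel_measurable M"
    unfolding rel_ent_def by measurable
qed (use assms rel_ent_bounded in blast)

text \<open>Jensen's inequality in two variables: integrate the tangent plane taken at the pair of
  means, where it agrees with \<open>rel_ent\<close>.\<close>

lemma (in prob_space) rel_ent_integral_le: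
  assumes [measurable]: "g \<in> borel_measurable M" "c \<in> borel_measurable M"
    and a: "0 < a" and g: "\<And>x. x \<in> space M \<Longrightarrow> g x \<in> {a..b}"
    and c: "\<And>x. x \<in> space M \<Longrightarrow> c x \<in> {a..b}"
  shows "rel_ent (\<integral>x. g x \<partial>M) (\<integral>x. c x \<partial>M) \<le> (\<integral>x. rel_ent (g x) (c x) \<partial>M)"
proof -
  define G where "G = (\<integral>x. g x \<partial>M)"
  define C where "C = (\<integral>x. c x \<partial>M)"
  have I: "integrable M g" "integrable M c"
    and "G \<in> {a..b}" "C \<in> {a..b}"
    using integral_in_interval[of g a b] integral_in_interval[of c a b] g c
    by (auto simp: G_def C_def)
  then have GC: "G > 0" "C > 0" using a by auto
  have "rel_ent G C = (\<integral>x. g x * (ln G - ln C) + c x * (1 - G / C) \<partial>M)"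
    using I GC by (simp add: rel_ent_def G_def[symmetric] C_def[symmetric] field_simps)
  also have "\<dots> \<le> (\<integral>x. rel_ent (g x) (c x) \<partial>M)"
  proof (rule integral_mono)
    show "integrable M (\<lambda>x. rel_ent (g x) (c x))"
      by (rule integrable_rel_ent[OF _ _ a g c]) auto
    show "g x * (ln G - ln C) + c x * (1 - G / C) \<le> rel_ent (g x) (c x)"
      if "x \<in> space M" for x
      using rel_ent_tangent[of "g x" "c x" G C] g[OF that] c[OF that] a GC by auto
  qed (use I in auto)
  finally show ?thesis by (simp add: G_def C_def)
qed

text \<open>The two sides differ by exactly \<open>rel_ent G c\<close>, with \<open>G\<close> the
  mean of \<open>g\<close>, and this is nonnegative. Thus the mean is the optimal constant, and any
  other one still gives an upper bound.\<close>

lemma (in prob_space) entropy_of_le: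
  assumes [measurable]: "g \<in> borel_measurable M"
    and a: "0 < a" and g: "\<And>x. x \<in> space M \<Longrightarrow> g x \<in> {a..b}" and c: "c > 0"
  shows "entropy_of M g \<le> (\<integral>x. rel_ent (g x) c \<partial>M)"
proof -
  define G where "G = (\<integral>x. g x \<partial>M)"
  have I: "integrable M g" "integrable M (\<lambda>x. g x * ln (g x))" and "G \<in> {a..b}"
    using integral_in_interval[of g a b] integrable_mult_ln[OF _ a g] g by (auto simp: G_def)
  then have "G > 0" using a by auto
  have "(\<integral>x. rel_ent (g x) c \<partial>M) = (\<integral>x. g x * ln (g x) - g x * ln c - g x + c \<partial>M)"
    by (simp add: rel_ent_def algebra_simps)
  also have "\<dots> = (\<integral>x. g x * ln (g x) \<partial>M) - G * ln c - G + c"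
    using I by (simp add: G_def prob_space)
  also have "\<dots> = entropy_of M g + rel_ent G c"
    by (simp add: entropy_of_def rel_ent_def G_def algebra_simps)
  finally show ?thesis using rel_ent_nonneg[OF \<open>G > 0\<close> c] by simp
qed

section \<open>Subadditivity of entropy over finite products\<close>

text \<open>Induction on \<open>J\<close>: the chain rule splits the entropy into the part along the new coordinate
  and the entropy of the marginal; the joint convexity of \<open>rel_ent\<close> lets the
  marginals of \<open>g\<close> and \<open>c j\<close> satisfy the same bound.\<close>

lemma (in product_prob_space) entropy_of_PiM_le:
  assumes "finite J" "g \<in> borel_measurable (Pi\<^sub>M J M)"
    and "\<And>j. j \<in> J \<Longrightarrow> c j \<in> borel_measurable (Pi\<^sub>M J M)"
    and a: "0 < a" and "\<And>x. x \<in> space (Pi\<^sub>M J M) \<Longrightarrow> g x \<in> {a..b}"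
    and "\<And>j x. j \<in> J \<Longrightarrow> x \<in> space (Pi\<^sub>M J M) \<Longrightarrow> c j x \<in> {a..b}"
    and "\<And>j x y. j \<in> J \<Longrightarrow> x \<in> space (Pi\<^sub>M J M) \<Longrightarrow> y \<in> space (M j) \<Longrightarrow> c j (x(j := y)) = c j x"
  shows "entropy_of (Pi\<^sub>M J M) g \<le> (\<Sum>j\<in>J. \<integral>x. rel_ent (g x) (c j x) \<partial>Pi\<^sub>M J M)"
  using assms(1-3,5-)
proof (induction J arbitrary: g c rule: finite_induct)
  case empty
  \<comment> \<open>The empty product is a point mass, so every function on it is almost surely
    constant and has no entropy.\<close>
  have "entropy_of (Pi\<^sub>M {} M) g = 0"
    by (simp add: entropy_of_def PiM_empty lebesgue_integral_count_space_finite)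
  then show ?case by simp
next
  case (insert k J)
  let ?P = "Pi\<^sub>M J M" and ?Q = "Pi\<^sub>M (insert k J) M"
  interpret J: prob_space ?P by (intro prob_space_PiM prob_space)
  interpret kJ: prob_space ?Q by (intro prob_space_PiM prob_space)
  note gm[measurable] = insert.prems(1)
  note g = insert.prems(3) and c = insert.prems(4)
  have upd: "x(k := y) \<in> space ?Q" if "x \<in> space ?P" "y \<in> space (M k)" for x y
    using that by (auto simp: space_PiM PiE_iff extensional_def)
  have joint: "(\<lambda>(x, y). h (x(k := y))) \<in> borel_measurable (?P \<Otimes>\<^sub>M M k)"
    if "h \<in> borel_measurable ?Q" for h :: "_ \<Rightarrow> real"
    using measurable_comp[OF measurable_add_dim that] by (simp add: comp_def case_prod_unfold)
  have slice: "(\<lambda>y. h (x(k := y))) \<in> borel_measurable (M k)"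
    if "h \<in> borel_measurable ?Q" "x \<in> space ?P" for h :: "_ \<Rightarrow> real" and x
    using measurable_Pair2[OF joint[OF that(1)] that(2)] by simp
  have marg: "(\<lambda>x. \<integral>y. h (x(k := y)) \<partial>M k) \<in> borel_measurable ?P"
    if "h \<in> borel_measurable ?Q" for h :: "_ \<Rightarrow> real"
    using joint[OF that] by (rule M.borel_measurable_lebesgue_integral)
  note fub = product_integral_insert[OF insert.hyps(1,2)]
  define G where "G x = (\<integral>y. g (x(k := y)) \<partial>M k)" for x
  define C where "C j x = (\<integral>y. c j (x(k := y)) \<partial>M k)" for j x
  have Gm[measurable]: "G \<in> borel_measurable ?P" unfolding G_def by (rule marg[OF gm])
  have Cm: "C j \<in> borel_measurable ?P" if "j \<in> J" for j
    unfolding C_def by (rule marg) (use insert.prems(2) that in auto)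
  have Gi: "G x \<in> {a..b}" if "x \<in> space ?P" for x
    unfolding G_def using slice[OF gm that] g upd that by (intro M.integral_in_interval) auto
  have Ci: "C j x \<in> {a..b}" if "j \<in> J" "x \<in> space ?P" for j x
    unfolding C_def
  proof (rule M.integral_in_interval(2))
    show "(\<lambda>y. c j (x(k := y))) \<in> borel_measurable (M k)"
      using that by (intro slice insert.prems(2)) auto
    show "c j (x(k := y)) \<in> {a..b}" if "y \<in> space (M k)" for y
      using that \<open>j \<in> J\<close> \<open>x \<in> space ?P\<close> by (intro c upd) auto
  qed
  \<comment> \<open>Updates at \<open>k\<close> and \<open>j\<close> commute since \<open>k\<close>
    is not in \<open>J\<close>, so independence of coordinate \<open>j\<close> survives averaging
    over coordinate \<open>k\<close>. This makes \<open>C\<close> admissible for the induction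
    hypothesis.\<close>
  have Cu: "C j (x(j := y)) = C j x" if "j \<in> J" "x \<in> space ?P" "y \<in> space (M j)" for j x y
  proof -
    have "k \<noteq> j" using that insert.hyps by auto
    have "c j (x(j := y, k := z)) = c j (x(k := z))" if "z \<in> space (M k)" for z
    proof -
      have "c j (x(k := z, j := y)) = c j (x(k := z))"
        using that \<open>j \<in> J\<close> \<open>x \<in> space ?P\<close> \<open>y \<in> space (M j)\<close>
        by (intro insert.prems(5) upd) auto
      then show ?thesis by (simp only: fun_upd_twist[OF \<open>k \<noteq> j\<close>])
    qed
    then show ?thesis unfolding C_def by (intro Bochner_Integration.integral_cong) auto
  qed
  have IH: "entropy_of ?P G \<le> (\<Sum>j\<in>J. \<integral>x. rel_ent (G x) (C j x) \<partial>?P)"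
    by (rule insert.IH[of G C, OF Gm Cm Gi Ci Cu])
  have mI: "integrable ?P (\<lambda>x. \<integral>y. h (x(k := y)) \<partial>M k)"
    and iI: "integrable ?Q h"
    if "h \<in> borel_measurable ?Q" "\<And>x. x \<in> space ?Q \<Longrightarrow> \<bar>h x\<bar> \<le> B" for h :: "_ \<Rightarrow> real" and B
  proof -
    show "integrable ?Q h" using that by (rule kJ.integrable_bounded)
    show "integrable ?P (\<lambda>x. \<integral>y. h (x(k := y)) \<partial>M k)"
    proof (rule J.integral_in_interval(1)[OF marg[OF that(1)]])
      fix x assume x: "x \<in> space ?P"
      show "(\<integral>y. h (x(k := y)) \<partial>M k) \<in> {-B..B}"
        by (rule M.integral_in_interval(2)[OF slice[OF that(1) x]])
          (use that(2)[OF upd[OF x]] in \<open>auto simp: abs_le_iff minus_le_iff\<close>)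
    qed
  qed
  have relm: "(\<lambda>x. rel_ent (g x) (c j x)) \<in> borel_measurable ?Q" if "j \<in> insert k J" for j
    using insert.prems(2)[OF that] unfolding rel_ent_def by measurable
  have relb: "\<bar>rel_ent (g x) (c j x)\<bar> \<le> b * (ln b - ln a) + (b - a)"
    if "j \<in> insert k J" "x \<in> space ?Q" for x j
    using rel_ent_bounded[OF a g c] that by auto
  \<comment> \<open>The bound comes from comparing \<open>g x\<close> with the constant
    \<open>a\<close> through \<open>rel_ent\<close>. Its size is immaterial: it only serves
    integrability.\<close>
  have lnb: "\<bar>g x * ln (g x)\<bar> \<le> b * (ln b - ln a) + (b - a) + b * \<bar>ln a\<bar> + 2 * \<bar>b\<bar> + \<bar>a\<bar>"
    if "x \<in> space ?Q" for x
  proof -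
    have *: "g x \<in> {a..b}" "a \<in> {a..b}" using g[OF that] by auto
    have "\<bar>g x * ln a\<bar> \<le> b * \<bar>ln a\<bar>" unfolding abs_mult using * a by (intro mult_right_mono) auto
    moreover have "\<bar>rel_ent (g x) a\<bar> \<le> b * (ln b - ln a) + (b - a)"
      by (rule rel_ent_bounded[OF a *])
    moreover have "g x * ln (g x) = rel_ent (g x) a + g x * ln a + g x - a"
      by (simp add: rel_ent_def algebra_simps)
    ultimately show ?thesis using * a by (auto simp del: mult_minus_left)
  qed
  have lnm: "(\<lambda>x. g x * ln (g x)) \<in> borel_measurable ?Q" by measurable
  have GI: "integrable ?P (\<lambda>x. G x * ln (G x))"
    by (rule J.integrable_mult_ln[OF Gm a Gi])
  have "entropy_of ?Q g = (\<integral>x. \<integral>y. g (x(k := y)) * ln (g (x(k := y))) \<partial>M k \<partial>?P)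
      - (\<integral>x. G x \<partial>?P) * ln (\<integral>x. G x \<partial>?P)"
    using fub[OF iI[OF lnm lnb]] fub[OF kJ.integral_in_interval(1)[OF gm g]]
    by (simp only: entropy_of_def G_def)
  \<comment> \<open>The chain rule: the integral of \<open>G x * ln (G x)\<close> is subtracted in
    the first term and added back in the second.\<close>
  also have "\<dots> = (\<integral>x. entropy_of (M k) (\<lambda>y. g (x(k := y))) \<partial>?P) + entropy_of ?P G"
    using mI[OF lnm lnb] GI by (simp add: entropy_of_def flip: G_def)
  also have "(\<integral>x. entropy_of (M k) (\<lambda>y. g (x(k := y))) \<partial>?P) \<le>
      (\<integral>x. \<integral>y. rel_ent (g (x(k := y))) (c k (x(k := y))) \<partial>M k \<partial>?P)"
  proof (rule integral_mono)
    show "integrable ?P (\<lambda>x. entropy_of (M k) (\<lambda>y. g (x(k := y))))"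
      unfolding entropy_of_def using mI[OF lnm lnb] GI by (simp flip: G_def)
    show "integrable ?P (\<lambda>x. \<integral>y. rel_ent (g (x(k := y))) (c k (x(k := y))) \<partial>M k)"
      by (rule mI[OF relm relb]) auto
    fix x assume x: "x \<in> space ?P"
    \<comment> \<open>On the slice through \<open>x\<close>, \<open>c k\<close> is constant; the
      arbitrary point \<open>z\<close> names that constant, so that the variational bound applies
      with it.\<close>
    obtain z where z: "z \<in> space (M k)" using M.not_empty by auto
    have eq: "c k (x(k := y)) = c k (x(k := z))" if "y \<in> space (M k)" for y
    proof -
      have "c k (x(k := z, k := y)) = c k (x(k := z))"
        by (intro insert.prems(5) upd x z that insertI1)
      then show ?thesis by (simp only: fun_upd_upd)
    qed
    have "entropy_of (M k) (\<lambda>y. g (x(k := y))) \<le>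
        (\<integral>y. rel_ent (g (x(k := y))) (c k (x(k := z))) \<partial>M k)"
    proof (intro M.entropy_of_le[OF slice[OF gm x] a g] upd x)
      have "c k (x(k := z)) \<in> {a..b}" by (intro c upd x z insertI1)
      with a show "0 < c k (x(k := z))" by (meson atLeastAtMost_iff less_le_trans)
    qed
    also have "\<dots> = (\<integral>y. rel_ent (g (x(k := y))) (c k (x(k := y))) \<partial>M k)"
      by (intro Bochner_Integration.integral_cong) (auto simp: eq)
    finally show "entropy_of (M k) (\<lambda>y. g (x(k := y))) \<le>
        (\<integral>y. rel_ent (g (x(k := y))) (c k (x(k := y))) \<partial>M k)" .
  qed
  also have "(\<integral>x. \<integral>y. rel_ent (g (x(k := y))) (c k (x(k := y))) \<partial>M k \<partial>?P)
      = (\<integral>x. rel_ent (g x) (c k x) \<partial>?Q)"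
    by (rule fub[symmetric, OF iI[OF relm relb]]) auto
  also note IH
  \<comment> \<open>Jensen's inequality on each slice along coordinate \<open>k\<close>, followed by
    Fubini.\<close>
  also have "(\<Sum>j\<in>J. \<integral>x. rel_ent (G x) (C j x) \<partial>?P) \<le> (\<Sum>j\<in>J. \<integral>x. rel_ent (g x) (c j x) \<partial>?Q)"
  proof (rule sum_mono)
    fix j assume j: "j \<in> J"
    then have jk: "j \<in> insert k J" by simp
    have "(\<integral>x. rel_ent (G x) (C j x) \<partial>?P) \<le>
        (\<integral>x. \<integral>y. rel_ent (g (x(k := y))) (c j (x(k := y))) \<partial>M k \<partial>?P)"
    proof (rule integral_mono)
      show "integrable ?P (\<lambda>x. rel_ent (G x) (C j x))"
        by (rule J.integrable_rel_ent[OF Gm Cm[OF j] a Gi Ci[OF j]])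
      show "integrable ?P (\<lambda>x. \<integral>y. rel_ent (g (x(k := y))) (c j (x(k := y))) \<partial>M k)"
        by (rule mI[OF relm[OF jk] relb[OF jk]])
      show "rel_ent (G x) (C j x) \<le> (\<integral>y. rel_ent (g (x(k := y))) (c j (x(k := y))) \<partial>M k)"
        if x: "x \<in> space ?P" for x
        unfolding G_def C_def
        by (rule M.rel_ent_integral_le[OF slice[OF gm x] slice[OF insert.prems(2)[OF jk] x] a g c[OF jk]])
          (erule upd[OF x])+
    qed
    also have "\<dots> = (\<integral>x. rel_ent (g x) (c j x) \<partial>?Q)"
      by (rule fub[symmetric, OF iI[OF relm[OF jk] relb[OF jk]]])
    finally show "(\<integral>x. rel_ent (G x) (C j x) \<partial>?P) \<le> (\<integral>x. rel_ent (g x) (c j x) \<partial>?Q)" .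
  qed
  finally show ?case using insert.hyps by simp
qed

section \<open>Elementary exponential inequalities\<close>

text \<open>The Taylor bound \<open>1 + x + x\<^sup>2 / 2 \<le> exp x\<close> turns into an upper
  bound for the reciprocal, because the product of the two quadratics is
  \<open>1 + x ^ 4 / 4\<close>, which is at least 1.\<close>

lemma exp_minus_le_quadratic:
  fixes x :: real
  assumes "x \<ge> 0"
  shows "exp (- x) \<le> 1 - x + x\<^sup>2 / 2"
proof -
  have "(1 + x + x\<^sup>2 / 2) * (1 - x + x\<^sup>2 / 2) = 1 + x ^ 4 / 4"
    by (simp add: algebra_simps power2_eq_square power4_eq_xxxx)
  then have "1 \<le> (1 + x + x\<^sup>2 / 2) * (1 - x + x\<^sup>2 / 2)" by simp
  also have "\<dots> \<le> exp x * (1 - x + x\<^sup>2 / 2)"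
    using zero_le_power2[of "1 - x"]
    by (intro mult_right_mono exp_lower_Taylor_quadratic assms) (simp add: power2_diff)
  finally show ?thesis by (simp add: exp_minus field_simps)
qed

text \<open>This controls the Taylor remainder when the exponential moment is differentiated. The
  lower bound is convexity; for negative \<open>u\<close> the upper bound is the preceding lemma at
  \<open>- u\<close>.\<close>

lemma exp_second_order_bound:
  fixes u :: real
  assumes "\<bar>u\<bar> \<le> 1"
  shows "\<bar>exp u - 1 - u\<bar> \<le> u\<^sup>2"
proof -
  have "exp u \<le> 1 + u + u\<^sup>2"
  proof (cases "u \<ge> 0")
    case True
    then show ?thesis using exp_bound[of u] assms by simp
  next
    case False
    then have "exp u \<le> 1 + u + u\<^sup>2 / 2" using exp_minus_le_quadratic[of "- u"] by simp
    also have "\<dots> \<le> 1 + u + u\<^sup>2" by simp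
    finally show ?thesis .
  qed
  then show ?thesis using exp_ge_add_one_self[of u] by linarith
qed

lemma exp_mult_in_interval:
  assumes "\<bar>y\<bar> \<le> (B::real)"
  shows "exp (\<beta> * y) \<in> {exp (- \<bar>\<beta>\<bar> * B)..exp (\<bar>\<beta>\<bar> * B)}"
proof -
  have "\<bar>\<beta> * y\<bar> \<le> \<bar>\<beta>\<bar> * B" unfolding abs_mult using assms by (intro mult_left_mono) auto
  then show ?thesis by auto
qed

section \<open>Exponential moments of a bounded function, Herbst's argument and tail bounds\<close>

context prob_space
begin

context
  fixes f :: "'a \<Rightarrow> real" and B :: real
  assumes fm[measurable]: "f \<in> borel_measurable M"
    and fB: "\<And>x. x \<in> space M \<Longrightarrow> \<bar>f x\<bar> \<le> B"
begin

lemma integrable_exp_bounded: "integrable M (\<lambda>x. exp (\<beta> * f x))"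
  by (rule integral_in_interval(1)[OF _ exp_mult_in_interval[OF fB]]) measurable

lemma integral_exp_pos: "(\<integral>x. exp (\<beta> * f x) \<partial>M) > 0"
proof -
  have "(\<integral>x. exp (\<beta> * f x) \<partial>M) \<ge> exp (- \<bar>\<beta>\<bar> * B)"
    using integral_in_interval(2)[OF _ exp_mult_in_interval[OF fB], of \<beta>] by simp
  then show ?thesis by (rule less_le_trans[rotated]) simp
qed

lemma integrable_mult_exp_bounded: "integrable M (\<lambda>x. f x * exp (\<beta> * f x))"
proof (rule integrable_bounded)
  fix x assume "x \<in> space M"
  from fB[OF this] exp_mult_in_interval[OF fB[OF this], of \<beta>]
  show "\<bar>f x * exp (\<beta> * f x)\<bar> \<le> B * exp (\<bar>\<beta>\<bar> * B)"
    unfolding abs_mult by (intro mult_mono) auto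
qed measurable

text \<open>Boundedness of \<open>f\<close> makes the second-order remainder of the integrand
  uniform in \<open>x\<close>, so the difference quotient is within \<open>\<bar>h\<bar> * K\<close>
  of the claimed derivative. In \<open>K\<close>, the factor \<open>B\<^sup>2\<close> bounds the
  square of \<open>f\<close> and the exponential bounds \<open>exp (\<beta> * f x)\<close>.\<close>

lemma has_derivative_integral_exp:
  "((\<lambda>\<beta>. \<integral>x. exp (\<beta> * f x) \<partial>M) has_real_derivative (\<integral>x. f x * exp (\<beta> * f x) \<partial>M)) (at \<beta>)"
proof -
  define L where "L \<beta> = (\<integral>x. exp (\<beta> * f x) \<partial>M)" for \<beta>
  define L' where "L' = (\<integral>x. f x * exp (\<beta> * f x) \<partial>M)"
  define K where "K = B\<^sup>2 * exp (\<bar>\<beta>\<bar> * B)"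
  \<comment> \<open>The restriction on \<open>h\<close> keeps \<open>h * f x\<close> in [-1, 1], the
    range of \<open>exp_second_order_bound\<close>.\<close>
  have bound: "\<bar>(L (\<beta> + h) - L \<beta>) / h - L'\<bar> \<le> \<bar>h\<bar> * K" if "h \<noteq> 0" "\<bar>h\<bar> * B \<le> 1" for h
  proof -
    have eq: "L (\<beta> + h) - L \<beta> - h * L' =
        (\<integral>x. exp ((\<beta> + h) * f x) - exp (\<beta> * f x) - h * (f x * exp (\<beta> * f x)) \<partial>M)"
      using integrable_exp_bounded integrable_mult_exp_bounded by (simp add: L_def L'_def)
    have pt: "\<bar>exp ((\<beta> + h) * f x) - exp (\<beta> * f x) - h * (f x * exp (\<beta> * f x))\<bar> \<le> h\<^sup>2 * K"
      if x: "x \<in> space M" for x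
    proof -
      have "\<bar>h * f x\<bar> \<le> \<bar>h\<bar> * B" unfolding abs_mult using fB[OF x] by (intro mult_left_mono) auto
      then have 1: "\<bar>exp (h * f x) - 1 - h * f x\<bar> \<le> (h * f x)\<^sup>2"
        using \<open>\<bar>h\<bar> * B \<le> 1\<close> by (intro exp_second_order_bound) auto
      have "(f x)\<^sup>2 \<le> B\<^sup>2" using fB[OF x] by (simp add: abs_le_square_iff[symmetric])
      then have 2: "(h * f x)\<^sup>2 \<le> h\<^sup>2 * B\<^sup>2"
        unfolding power_mult_distrib by (intro mult_left_mono) auto
      have "exp ((\<beta> + h) * f x) - exp (\<beta> * f x) - h * (f x * exp (\<beta> * f x))
          = (exp (h * f x) - 1 - h * f x) * exp (\<beta> * f x)"
        by (simp add: algebra_simps exp_add)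
      also have "\<bar>\<dots>\<bar> \<le> (h\<^sup>2 * B\<^sup>2) * exp (\<bar>\<beta>\<bar> * B)"
        unfolding abs_mult using 1 2 exp_mult_in_interval[OF fB[OF x], of \<beta>]
        by (intro mult_mono) auto
      finally show ?thesis by (simp add: K_def)
    qed
    have "\<bar>L (\<beta> + h) - L \<beta> - h * L'\<bar> \<le> h\<^sup>2 * K"
      unfolding eq by (rule order_trans[OF integral_abs_bound integral_le_const])
        (use pt integrable_exp_bounded integrable_mult_exp_bounded in auto)
    then have "\<bar>L (\<beta> + h) - L \<beta> - h * L'\<bar> / \<bar>h\<bar> \<le> h\<^sup>2 * K / \<bar>h\<bar>"
      by (rule divide_right_mono) simp
    moreover have "(L (\<beta> + h) - L \<beta>) / h - L' = (L (\<beta> + h) - L \<beta> - h * L') / h"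
      using that by (simp add: field_simps)
    moreover have "h\<^sup>2 * K / \<bar>h\<bar> = \<bar>h\<bar> * K"
      using that by (simp add: power2_eq_square field_simps)
    ultimately show ?thesis by simp
  qed
  have "((\<lambda>h. (L (\<beta> + h) - L \<beta>) / h - L') \<longlongrightarrow> 0) (at 0)"
  proof (rule Lim_null_comparison)
    have "((\<lambda>h. \<bar>h\<bar> * B) \<longlongrightarrow> \<bar>0\<bar> * B) (at 0)" by (intro tendsto_intros)
    then have "eventually (\<lambda>h. \<bar>h\<bar> * B < 1) (at 0)" by (rule order_tendstoD(2)) simp
    then show "eventually (\<lambda>h. norm ((L (\<beta> + h) - L \<beta>) / h - L') \<le> \<bar>h\<bar> * K) (at 0)"
      using eventually_neq_at_within[of 0 0 UNIV] by eventually_elim (use bound in auto)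
    have "((\<lambda>h. \<bar>h\<bar> * K) \<longlongrightarrow> \<bar>0\<bar> * K) (at 0)" by (intro tendsto_intros)
    then show "((\<lambda>h. \<bar>h\<bar> * K) \<longlongrightarrow> 0) (at 0)" by simp
  qed
  from LIM_zero_cancel[OF this] show ?thesis
    unfolding DERIV_def L_def L'_def .
qed

text \<open>Herbst's argument: up to the factor \<open>1 / (\<beta>\<^sup>2 * expectation (\<lambda>x. exp (\<beta> * f x)))\<close>,
  the entropy of \<open>exp (\<beta> * f)\<close> is the derivative of
  \<open>ln (expectation (\<lambda>x. exp (\<beta> * f x))) / \<beta>\<close>, whose limit at \<open>0\<close> is \<open>expectation f\<close>.\<close>

lemma integral_exp_le_of_entropy:
  assumes ent: "\<And>\<beta>. \<beta> > 0 \<Longrightarrow>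
      entropy_of M (\<lambda>x. exp (\<beta> * f x)) \<le> \<beta>\<^sup>2 / 2 * D * (\<integral>x. exp (\<beta> * f x) \<partial>M)"
    and "\<beta> > 0"
  shows "(\<integral>x. exp (\<beta> * f x) \<partial>M) \<le> exp (\<beta> * (\<integral>x. f x \<partial>M) + \<beta>\<^sup>2 / 2 * D)"
proof -
  define L where "L \<beta> = (\<integral>x. exp (\<beta> * f x) \<partial>M)" for \<beta>
  define L' where "L' \<beta> = (\<integral>x. f x * exp (\<beta> * f x) \<partial>M)" for \<beta>
  \<comment> \<open>The entropy hypothesis bounds the derivative of
    \<open>ln (L \<beta>) / \<beta>\<close> by \<open>D / 2\<close>; subtracting
    \<open>\<beta> * D / 2\<close> therefore makes \<open>H\<close> nonincreasing on the positive
    axis.\<close>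
  define H where "H \<beta> = ln (L \<beta>) / \<beta> - \<beta> * D / 2" for \<beta>
  have Lpos: "L \<beta> > 0" for \<beta> using integral_exp_pos by (simp add: L_def)
  have dL: "(L has_real_derivative L' \<beta>) (at \<beta>)" for \<beta>
    using has_derivative_integral_exp unfolding L_def L'_def .
  have dlnL: "((\<lambda>\<beta>. ln (L \<beta>)) has_real_derivative L' \<beta> / L \<beta>) (at \<beta>)" for \<beta>
    using DERIV_ln_divide[OF Lpos] DERIV_chain2[OF _ dL] by fastforce
  have L'_le: "L' b / L b / b - ln (L b) / b\<^sup>2 \<le> D / 2" if "b > 0" for b
  proof -
    have "entropy_of M (\<lambda>x. exp (b * f x)) = b * L' b - L b * ln (L b)"
      by (simp add: entropy_of_def L_def L'_def mult_ac flip: integral_mult_right_zero)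
    with ent[OF that] have "b * L' b - L b * ln (L b) \<le> b\<^sup>2 / 2 * D * L b" by (simp add: L_def)
    then have "(b * L' b - L b * ln (L b)) / (b\<^sup>2 * L b) \<le> (b\<^sup>2 / 2 * D * L b) / (b\<^sup>2 * L b)"
      using Lpos[of b] by (intro divide_right_mono) auto
    moreover have "(b * L' b - L b * ln (L b)) / (b\<^sup>2 * L b) = L' b / L b / b - ln (L b) / b\<^sup>2"
      using Lpos[of b] that by (simp add: field_simps power2_eq_square)
    ultimately show ?thesis using Lpos[of b] that by simp
  qed
  have H_mono: "H \<beta> \<le> H c" if "0 < c" "c \<le> \<beta>" for c
  proof (rule DERIV_nonpos_imp_nonincreasing[OF \<open>c \<le> \<beta>\<close>])
    fix b assume "c \<le> b" "b \<le> \<beta>"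
    then have b: "b > 0" using that by simp
    have "(H has_real_derivative (L' b / L b * b - ln (L b) * 1) / (b * b) - D / 2) (at b)"
      unfolding H_def using b by (intro DERIV_diff DERIV_divide dlnL DERIV_ident) (auto intro!: derivative_eq_intros)
    moreover have "(L' b / L b * b - ln (L b) * 1) / (b * b) - D / 2 \<le> 0"
      using L'_le[OF b] b by (simp add: field_simps power2_eq_square)
    ultimately show "\<exists>y. (H has_real_derivative y) (at b) \<and> y \<le> 0" by blast
  qed
  have "L 0 = 1" "L' 0 = (\<integral>x. f x \<partial>M)" by (simp_all add: L_def L'_def prob_space)
  \<comment> \<open>Since \<open>ln (L 0) = 0\<close>, this quotient is the difference quotient of
    \<open>ln (L b)\<close> at 0, with limit \<open>L' 0 / L 0\<close>.\<close>
  then have "((\<lambda>b. ln (L b) / b) \<longlongrightarrow> (\<integral>x. f x \<partial>M)) (at 0)"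
    using dlnL[of 0] by (simp add: DERIV_def)
  then have "(H \<longlongrightarrow> (\<integral>x. f x \<partial>M) - 0 * D / 2) (at 0)"
    unfolding H_def by (intro tendsto_intros) auto
  then have lim: "(H \<longlongrightarrow> (\<integral>x. f x \<partial>M)) (at_right 0)"
    by (simp add: filterlim_at_split)
  have "H \<beta> \<le> (\<integral>x. f x \<partial>M)"
  proof (rule tendsto_lowerbound[OF lim])
    show "eventually (\<lambda>b. H \<beta> \<le> H b) (at_right 0)"
      using eventually_at_right_less[of 0] eventually_at_rightI[of 0 \<beta> "\<lambda>b. b < \<beta>"] \<open>\<beta> > 0\<close>
      by (auto elim!: eventually_elim2 intro!: H_mono)
  qed simp
  then have "ln (L \<beta>) \<le> \<beta> * (\<integral>x. f x \<partial>M) + \<beta>\<^sup>2 / 2 * D"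
    using \<open>\<beta> > 0\<close> by (simp add: H_def field_simps power2_eq_square)
  then show ?thesis using Lpos[of \<beta>]
    by (metis L_def exp_le_cancel_iff exp_ln)
qed

lemma tail_le_of_entropy:
  assumes ent: "\<And>\<beta>. \<beta> > 0 \<Longrightarrow>
      entropy_of M (\<lambda>x. exp (\<beta> * f x)) \<le> \<beta>\<^sup>2 / 2 * D * (\<integral>x. exp (\<beta> * f x) \<partial>M)"
    and "D \<ge> 0" "t > 0"
  shows "\<P>(x in M. f x - (\<integral>x. f x \<partial>M) > t) \<le> (if D = 0 then 0 else exp (- t\<^sup>2 / (2 * D)))"
proof -
  define E where "E = (\<integral>x. f x \<partial>M)"
  define p where "p = \<P>(x in M. f x - E > t)"
  have p_le: "p \<le> exp (\<beta>\<^sup>2 / 2 * D - \<beta> * t)" if "\<beta> > 0" for \<beta>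
  proof -
    have "p \<le> \<P>(x in M. exp (\<beta> * f x) \<ge> exp (\<beta> * (E + t)))"
      unfolding p_def using that by (intro finite_measure_mono) auto
    also have "\<dots> \<le> (\<integral>x. exp (\<beta> * f x) \<partial>M) / exp (\<beta> * (E + t))"
      by (rule integral_Markov_inequality_measure[OF integrable_exp_bounded, where A = "space M"]) auto
    also have "\<dots> \<le> exp (\<beta> * E + \<beta>\<^sup>2 / 2 * D) / exp (\<beta> * (E + t))"
      using integral_exp_le_of_entropy[OF ent that] by (intro divide_right_mono) (auto simp: E_def)
    also have "\<dots> = exp (\<beta>\<^sup>2 / 2 * D - \<beta> * t)"
      by (simp add: exp_diff[symmetric] algebra_simps)
    finally show ?thesis .
  qed
  show ?thesis
  proof (cases "D = 0")
    case True
    have "((\<lambda>\<beta>. exp (- (\<beta> * t))) \<longlongrightarrow> 0) at_top"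
      using \<open>t > 0\<close> by real_asymp
    moreover have "eventually (\<lambda>\<beta>. p \<le> exp (- (\<beta> * t))) at_top"
      using eventually_gt_at_top[of 0] by eventually_elim (use p_le True in auto)
    ultimately have "p \<le> 0" by (rule tendsto_lowerbound) simp
    then show ?thesis using True by (simp add: p_def E_def)
  next
    case False
    then have "D > 0" using \<open>D \<ge> 0\<close> by simp
    \<comment> \<open>The choice \<open>t / D\<close> minimises the quadratic exponent in
      \<beta>.\<close>
    with p_le[of "t / D"] \<open>t > 0\<close> have "p \<le> exp ((t / D)\<^sup>2 / 2 * D - t / D * t)" by simp
    also have "(t / D)\<^sup>2 / 2 * D - t / D * t = - t\<^sup>2 / (2 * D)"
      using \<open>D > 0\<close> by (simp add: field_simps power2_eq_square)
    finally show ?thesis using False by (simp add: p_def E_def)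
  qed
qed

end

end

section \<open>Coordinatewise infima and the essential supremum norm\<close>

lemma inf_coord_upd: "inf_coord M k f (x(k := y)) = inf_coord M k f x"
  by (simp add: inf_coord_def)

lemma inf_coord_bounds:
  assumes "\<And>x. x \<in> space (Pi\<^sub>M I M) \<Longrightarrow> \<bar>f x\<bar> \<le> B" "k \<in> I" "x \<in> space (Pi\<^sub>M I M)"
  shows "inf_coord M k f x \<le> f x" "\<bar>inf_coord M k f x\<bar> \<le> B"
proof -
  have xk: "x k \<in> space (M k)" using assms(2,3) by (auto simp: space_PiM)
  have upd: "x(k := y) \<in> space (Pi\<^sub>M I M)" if "y \<in> space (M k)" for y
    using that assms(2,3) by (auto simp: space_PiM PiE_iff extensional_def)
  have b: "- B \<le> f (x(k := y))" if "y \<in> space (M k)" for y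
    using assms(1)[OF upd[OF that]] by linarith
  \<comment> \<open>A real infimum lies below its members only if the set is bounded below. The
    member used next is the one at \<open>y = x k\<close>, where the update leaves \<open>x\<close>
    unchanged.\<close>
  then have "bdd_below ((\<lambda>y. f (x(k := y))) ` space (M k))" by (intro bdd_belowI2)
  from cINF_lower[OF this xk] show *: "inf_coord M k f x \<le> f x" by (simp add: inf_coord_def)
  have "- B \<le> inf_coord M k f x"
    unfolding inf_coord_def using xk b by (intro cINF_greatest) auto
  with * assms(1)[OF assms(3)] show "\<bar>inf_coord M k f x\<bar> \<le> B" by linarith
qed

lemma AE_abs_le_Linf_norm:
  fixes g :: "'a \<Rightarrow> real"
  assumes "prob_space M" and [measurable]: "g \<in> borel_measurable M"
    and "\<And>x. x \<in> space M \<Longrightarrow> \<bar>g x\<bar> \<le> K"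
  shows "AE x in M. \<bar>g x\<bar> \<le> Linf_norm M g" "Linf_norm M g \<ge> 0"
proof -
  interpret prob_space M by fact
  let ?e = "esssup M (\<lambda>x. ereal \<bar>g x\<bar>)"
  have "?e \<le> ereal K" using assms(3) by (intro esssup_I) auto
  moreover have "esssup M (\<lambda>x. ereal 0) \<le> ?e" by (intro esssup_AE_mono) auto
  then have "0 \<le> ?e" using esssup_const[of M "ereal 0"] by (simp add: emeasure_space_1 zero_ereal_def)
  \<comment> \<open>Finiteness is essential: \<open>real_of_ereal\<close> sends infinite values to
    0, so only now does \<open>Linf_norm\<close> carry the essential supremum itself.\<close>
  ultimately have "\<bar>?e\<bar> \<noteq> \<infinity>" by auto
  then have e: "?e = ereal (Linf_norm M g)" by (simp add: Linf_norm_def ereal_real)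
  show "AE x in M. \<bar>g x\<bar> \<le> Linf_norm M g"
    using esssup_AE[of "\<lambda>x. ereal \<bar>g x\<bar>" M] unfolding e by simp
  show "Linf_norm M g \<ge> 0" using \<open>0 \<le> ?e\<close> unfolding e by simp
qed

section \<open>The entropy of an exponential in terms of the variance proxy\<close>

text \<open>Factoring out \<open>exp u\<close> leaves the second-order remainder of exp at
  \<open>- (u - i)\<close>. The hypothesis \<open>i \<le> u\<close> puts this argument on the
  negative side, where the constant 1/2 is valid; hence the comparison of \<open>f\<close> with its
  infimum.\<close>

lemma rel_ent_exp_le:
  assumes "i \<le> u"
  shows "rel_ent (exp u) (exp i) \<le> exp u * ((u - i)\<^sup>2 / 2)"
proof -
  have "rel_ent (exp u) (exp i) = exp u * (exp (- (u - i)) - (1 - (u - i)))"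
    by (simp add: rel_ent_def algebra_simps flip: exp_add)
  also have "\<dots> \<le> exp u * ((u - i)\<^sup>2 / 2)"
    using exp_minus_le_quadratic[of "u - i"] assms by (intro mult_left_mono) auto
  finally show ?thesis .
qed

text \<open>The infimum over coordinate \<open>k\<close> does not depend on that coordinate, so
  \<open>exp (\<beta> * inf_coord M k f x)\<close> is an admissible comparison function in the
  subadditivity bound. Summing the pointwise estimates then produces the sum of squares bounded by
  \<open>D\<close>.\<close>

lemma (in product_prob_space) entropy_of_exp_le_variance_proxy:
  fixes f :: "('i \<Rightarrow> 'a) \<Rightarrow> real"
  assumes J: "finite J" and [measurable]: "f \<in> borel_measurable (Pi\<^sub>M J M)"
    and fB: "\<And>x. x \<in> space (Pi\<^sub>M J M) \<Longrightarrow> \<bar>f x\<bar> \<le> B"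
    and im: "\<And>k. k \<in> J \<Longrightarrow> inf_coord M k f \<in> borel_measurable (Pi\<^sub>M J M)"
    and D: "AE x in Pi\<^sub>M J M. (\<Sum>k\<in>J. (f x - inf_coord M k f x)\<^sup>2) \<le> D"
    and "\<beta> > 0"
  shows "entropy_of (Pi\<^sub>M J M) (\<lambda>x. exp (\<beta> * f x)) \<le> \<beta>\<^sup>2 / 2 * D * (\<integral>x. exp (\<beta> * f x) \<partial>Pi\<^sub>M J M)"
proof -
  let ?P = "Pi\<^sub>M J M"
  interpret J: prob_space ?P by (intro prob_space_PiM prob_space)
  define a where "a = exp (- \<bar>\<beta>\<bar> * B)"
  define b where "b = exp (\<bar>\<beta>\<bar> * B)"
  have g: "exp (\<beta> * f x) \<in> {a..b}" if "x \<in> space ?P" for x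
    unfolding a_def b_def by (rule exp_mult_in_interval[OF fB[OF that]])
  have c: "exp (\<beta> * inf_coord M k f x) \<in> {a..b}" if "k \<in> J" "x \<in> space ?P" for k x
    unfolding a_def b_def by (rule exp_mult_in_interval[OF inf_coord_bounds(2)[OF fB that]])
  have a: "a > 0" by (simp add: a_def)
  have cm: "(\<lambda>x. exp (\<beta> * inf_coord M k f x)) \<in> borel_measurable ?P" if "k \<in> J" for k
    using im[OF that] by measurable
  have ri: "integrable ?P (\<lambda>x. rel_ent (exp (\<beta> * f x)) (exp (\<beta> * inf_coord M k f x)))" if "k \<in> J" for k
    by (rule J.integrable_rel_ent[OF _ cm[OF that] a g c[OF that]]) measurable
  have gi: "integrable ?P (\<lambda>x. exp (\<beta> * f x))"
    by (rule J.integral_in_interval(1)[OF _ g]) measurable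
  have "entropy_of ?P (\<lambda>x. exp (\<beta> * f x))
      \<le> (\<Sum>k\<in>J. \<integral>x. rel_ent (exp (\<beta> * f x)) (exp (\<beta> * inf_coord M k f x)) \<partial>?P)"
    by (rule entropy_of_PiM_le[OF J _ cm a g c]) (simp_all add: inf_coord_upd)
  also have "\<dots> = (\<integral>x. (\<Sum>k\<in>J. rel_ent (exp (\<beta> * f x)) (exp (\<beta> * inf_coord M k f x))) \<partial>?P)"
    using ri by (simp add: Bochner_Integration.integral_sum)
  also have "\<dots> \<le> (\<integral>x. \<beta>\<^sup>2 / 2 * D * exp (\<beta> * f x) \<partial>?P)"
  \<comment> \<open>Monotonicity is needed in its almost-everywhere form, since \<open>D\<close> is
    only an essential bound.\<close>
  proof (rule integral_mono_AE)
    show "AE x in ?P. (\<Sum>k\<in>J. rel_ent (exp (\<beta> * f x)) (exp (\<beta> * inf_coord M k f x)))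
        \<le> \<beta>\<^sup>2 / 2 * D * exp (\<beta> * f x)"
      using D AE_space
    proof eventually_elim
      fix x assume x: "x \<in> space ?P" and *: "(\<Sum>k\<in>J. (f x - inf_coord M k f x)\<^sup>2) \<le> D"
      have "(\<Sum>k\<in>J. rel_ent (exp (\<beta> * f x)) (exp (\<beta> * inf_coord M k f x)))
          \<le> (\<Sum>k\<in>J. exp (\<beta> * f x) * ((\<beta> * f x - \<beta> * inf_coord M k f x)\<^sup>2 / 2))"
        using inf_coord_bounds(1)[OF fB _ x] \<open>\<beta> > 0\<close>
        by (intro sum_mono rel_ent_exp_le mult_left_mono) auto
      also have "\<dots> = \<beta>\<^sup>2 / 2 * exp (\<beta> * f x) * (\<Sum>k\<in>J. (f x - inf_coord M k f x)\<^sup>2)"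
        by (simp add: sum_distrib_left power_mult_distrib mult_ac flip: right_diff_distrib)
      also have "\<dots> \<le> \<beta>\<^sup>2 / 2 * exp (\<beta> * f x) * D"
        using * by (intro mult_left_mono) auto
      finally show "(\<Sum>k\<in>J. rel_ent (exp (\<beta> * f x)) (exp (\<beta> * inf_coord M k f x)))
          \<le> \<beta>\<^sup>2 / 2 * D * exp (\<beta> * f x)" by (simp add: mult_ac)
    qed
  qed (use gi ri in auto)
  also have "\<dots> = \<beta>\<^sup>2 / 2 * D * (\<integral>x. exp (\<beta> * f x) \<partial>?P)"
    by (rule integral_mult_right_zero)
  finally show ?thesis .
qed

section \<open>The tail bound for product measures\<close>

theorem theorem16:
  fixes n :: nat
    and M :: "nat \<Rightarrow> 'a measure"
    and f :: "(nat \<Rightarrow> 'a) \<Rightarrow> real"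
    and t :: real
  assumes "\<And>k. k \<in> {1..n} \<Longrightarrow> prob_space (M k)"
    and "f \<in> borel_measurable (Pi\<^sub>M {1..n} M)"
    and "\<exists>B. \<forall>x\<in>space (Pi\<^sub>M {1..n} M). \<bar>f x\<bar> \<le> B"
    and "\<And>k. k \<in> {1..n} \<Longrightarrow> inf_coord M k f \<in> borel_measurable (Pi\<^sub>M {1..n} M)"
    and "t > 0"
  shows "\<P>(x in Pi\<^sub>M {1..n} M. f x - integral\<^sup>L (Pi\<^sub>M {1..n} M) f > t)
    \<le> (if Linf_norm (Pi\<^sub>M {1..n} M) (variance_proxy M n f) = 0 then 0
        else exp (- t\<^sup>2 / (2 * Linf_norm (Pi\<^sub>M {1..n} M) (variance_proxy M n f))))"
proof -
  let ?P = "Pi\<^sub>M {1..n} M"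
  note [measurable] = assms(2)
  obtain B where fB: "\<And>x. x \<in> space ?P \<Longrightarrow> \<bar>f x\<bar> \<le> B" using assms(3) by blast
  \<comment> \<open>The library's product locales require every factor, not only those with index in
    \<open>{1..n}\<close>, to be a probability space.\<close>
  define N where "N k = (if k \<in> {1..n} then M k else return (count_space UNIV) undefined)" for k
  have N: "prob_space (N k)" for k
    using assms(1) by (auto simp: N_def intro!: prob_space_return)
  interpret product_prob_space N "{1..n}"
    using N by (auto intro!: product_prob_space.intro product_sigma_finite.intro
      product_prob_space_axioms.intro prob_space_imp_sigma_finite)
  have P: "Pi\<^sub>M {1..n} N = ?P" by (intro PiM_cong) (auto simp: N_def)
  have inf_N: "inf_coord N k f = inf_coord M k f" if "k \<in> {1..n}" for k
    using that by (auto simp: inf_coord_def N_def)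
  interpret prod: prob_space ?P using assms(1) by (rule prob_space_PiM)
  have Dm: "variance_proxy M n f \<in> borel_measurable ?P"
    unfolding variance_proxy_def
    by (intro borel_measurable_sum borel_measurable_power borel_measurable_diff assms(2,4))
  \<comment> \<open>Both \<open>f\<close> and its infima lie in [-B, B], so each difference is at
    most \<open>2 * B\<close> in absolute value. The resulting bound guarantees a finite essential
    supremum.\<close>
  have DB: "\<bar>variance_proxy M n f x\<bar> \<le> (\<Sum>k = 1..n. (2 * B)\<^sup>2)" if x: "x \<in> space ?P" for x
  proof -
    have "(f x - inf_coord M k f x)\<^sup>2 \<le> (2 * B)\<^sup>2" if "k \<in> {1..n}" for k
    proof -
      have "\<bar>inf_coord M k f x\<bar> \<le> B" by (rule inf_coord_bounds(2)[OF fB that x])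
      with fB[OF x] have "\<bar>f x - inf_coord M k f x\<bar> \<le> \<bar>2 * B\<bar>" by linarith
      then show ?thesis by (simp only: abs_le_square_iff)
    qed
    then show ?thesis unfolding variance_proxy_def
      by (subst abs_of_nonneg) (auto intro!: sum_nonneg sum_mono simp del: sum_constant)
  qed
  have D: "AE x in ?P. \<bar>variance_proxy M n f x\<bar> \<le> Linf_norm ?P (variance_proxy M n f)"
    "Linf_norm ?P (variance_proxy M n f) \<ge> 0"
    using AE_abs_le_Linf_norm[OF prod.prob_space_axioms Dm DB] by blast+
  have "entropy_of ?P (\<lambda>x. exp (\<beta> * f x))
      \<le> \<beta>\<^sup>2 / 2 * Linf_norm ?P (variance_proxy M n f) * (\<integral>x. exp (\<beta> * f x) \<partial>?P)"
    if "\<beta> > 0" for \<beta>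
  proof (rule entropy_of_exp_le_variance_proxy[of "{1..n}" f B, unfolded P])
    show "AE x in ?P. (\<Sum>k = 1..n. (f x - inf_coord N k f x)\<^sup>2) \<le> Linf_norm ?P (variance_proxy M n f)"
      using D(1)
    proof eventually_elim
      case (elim x)
      moreover have "(\<Sum>k = 1..n. (f x - inf_coord N k f x)\<^sup>2) = variance_proxy M n f x"
        unfolding variance_proxy_def by (intro sum.cong) (auto simp: inf_N)
      ultimately show ?case by simp
    qed
  qed (use assms(2,4) fB that in \<open>auto simp: inf_N\<close>)
  from prod.tail_le_of_entropy[OF assms(2) fB this D(2) assms(5)] show ?thesis by simp
qed

end
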